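(* Let $M$, $N$ and $K$ be three weighted means (all of the same direction), and let $I,J,L\subseteq(0,\infty)$ be intervals. If $f:I\to J$ is an $MN$-convex function and $g:J\to L$ is a nondecreasing and $NK$-convex function, then $g\circ f$ is an $MK$-convex function.
   Context: A function $M:(0,\infty)\times(0,\infty)\times[0,1]\to(0,\infty)$ is called a weighted mean if the following hold. (WM1) $M(u,v,\lambda)=M(v,u,1-\lambda)$. (WM2) $M(u,u,\lambda)=u$. (WM3) $u<M(u,v,\lambda)<v$ whenever $u<v$ and $\lambda\in(0,1)$. (WM4) $M(\alpha u,\alpha v,\lambda)=\alpha M(u,v,\lambda)$ for all $\alpha>0$. (WM5) For fixed $\lambda\in[0,1]$: $M(u,v,\lambda)\le M(w,v,\lambda)$ whenever $u\le w$, and $M(u,v,\lambda)\le M(u,w,\lambda)$ whenever $v\le w$. (WM6) For fixed $u\ne v$, $M(u,v,\cdot)$ is strictly monotone and continuous on $[0,1]$ with range $[\min\{u,v\},\max\{u,v\}]$. Moreover $M$ has a direction: either $M(u,v,\cdot)$ is strictly increasing for all $u<v$ (positive direction; then $M(u,v,0)=u$, $M(u,v,1)=v$ for all $u,v$), or $M(u,v,\cdot)$ is strictly decreasing for all $u<v$ (negative direction; then $M(u,v,0)=v$, $M(u,v,1)=u$ for all $u,v$). (WM7) $M(M(u,v,\lambda),M(z,w,\lambda),s)=M(M(u,z,s),M(v,w,s),\lambda)$ for all $u,v,z,w>0$, $s,\lambda\in[0,1]$. (WM8) For all $u,v>0$, $s,\lambda_1,\lambda_2\in[0,1]$: $M(M(u,v,\lambda_1),M(u,v,\lambda_2),s)$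 equals $M(u,v,s\lambda_1+(1-s)\lambda_2)$ if $M$ has negative direction, and $M(u,v,(1-s)\lambda_1+s\lambda_2)$ if $M$ has positive direction. Standing assumption: all weighted means occurring together have the same direction. For weighted means $M,N$ and intervals $I,J\subseteq(0,\infty)$, a function $f:I\to J$ is $MN$-convex if $f(M(u,v,\lambda))\le N(f(u),f(v),\lambda)$ for all $u,v\in I$, $\lambda\in[0,1]$; $NK$-convexity and $MK$-convexity are defined likewise with the respective means. *)

theory Defs
  imports "HOL-Analysis.Analysis"
begin

(* Means are total functions on the reals; only the values on
   (0, inf) x (0, inf) x [0, 1] are constrained or used. *)

definition positive_direction :: "(real \<Rightarrow> real \<Rightarrow> real \<Rightarrow> real) \<Rightarrow> bool" where
  "positive_direction M \<longleftrightarrow> (\<forall>u v. 0 < u \<longrightarrow> u < v \<longrightarrow> strict_mono_on {0..1} (M u v))"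

definition negative_direction :: "(real \<Rightarrow> real \<Rightarrow> real \<Rightarrow> real) \<Rightarrow> bool" where
  "negative_direction M \<longleftrightarrow> (\<forall>u v. 0 < u \<longrightarrow> u < v \<longrightarrow> strict_antimono_on {0..1} (M u v))"

locale weighted_mean =
  fixes M :: "real \<Rightarrow> real \<Rightarrow> real \<Rightarrow> real"
  assumes pos: "\<lbrakk>0 < u; 0 < v; l \<in> {0..1}\<rbrakk> \<Longrightarrow> 0 < M u v l"
    and swap: "\<lbrakk>0 < u; 0 < v; l \<in> {0..1}\<rbrakk> \<Longrightarrow> M u v l = M v u (1 - l)"
    and idem: "\<lbrakk>0 < u; l \<in> {0..1}\<rbrakk> \<Longrightarrow> M u u l = u"
    and between: "\<lbrakk>0 < u; u < v; l \<in> {0<..<1}\<rbrakk> \<Longrightarrow> u < M u v l \<and> M u v l < v"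
    and homogeneous:
      "\<lbrakk>0 < u; 0 < v; l \<in> {0..1}; 0 < a\<rbrakk> \<Longrightarrow> M (a * u) (a * v) l = a * M u v l"
    and mono_left: "\<lbrakk>0 < u; 0 < v; l \<in> {0..1}; u \<le> w\<rbrakk> \<Longrightarrow> M u v l \<le> M w v l"
    and mono_right: "\<lbrakk>0 < u; 0 < v; l \<in> {0..1}; v \<le> w\<rbrakk> \<Longrightarrow> M u v l \<le> M u w l"
    and strictly_monotone: "\<lbrakk>0 < u; 0 < v; u \<noteq> v\<rbrakk> \<Longrightarrow>
      strict_mono_on {0..1} (M u v) \<or> strict_antimono_on {0..1} (M u v)"
    and continuous: "\<lbrakk>0 < u; 0 < v; u \<noteq> v\<rbrakk> \<Longrightarrow> continuous_on {0..1} (M u v)"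
    and range: "\<lbrakk>0 < u; 0 < v; u \<noteq> v\<rbrakk> \<Longrightarrow> M u v ` {0..1} = {min u v..max u v}"
    and direction: "positive_direction M \<or> negative_direction M"
    and bisymmetric:
      "\<lbrakk>0 < u; 0 < v; 0 < z; 0 < w; s \<in> {0..1}; l \<in> {0..1}\<rbrakk> \<Longrightarrow>
        M (M u v l) (M z w l) s = M (M u z s) (M v w s) l"
    and compose_negative:
      "\<lbrakk>negative_direction M; 0 < u; 0 < v; s \<in> {0..1}; l1 \<in> {0..1}; l2 \<in> {0..1}\<rbrakk> \<Longrightarrow>
        M (M u v l1) (M u v l2) s = M u v (s * l1 + (1 - s) * l2)"
    and compose_positive:
      "\<lbrakk>positive_direction M; 0 < u; 0 < v; s \<in> {0..1}; l1 \<in> {0..1}; l2 \<in> {0..1}\<rbrakk> \<Longrightarrow>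
        M (M u v l1) (M u v l2) s = M u v ((1 - s) * l1 + s * l2)"
begin

(* The boundary values attached to each direction follow from the other axioms. *)

lemma positive_direction_less:
  assumes "positive_direction M" "0 < u" "u < v"
  shows "M u v 0 = u" "M u v 1 = v"
proof -
  have m: "strict_mono_on {0..1} (M u v)"
    using assms by (auto simp: positive_direction_def)
  have r: "M u v ` {0..1} = {u..v}" using range[of u v] assms by simp
  have b: "M u v 0 \<le> M u v l \<and> M u v l \<le> M u v 1" if "l \<in> {0..1}" for l
    using strict_mono_on_leD[OF m] that by auto
  have "u \<in> M u v ` {0..1}" "v \<in> M u v ` {0..1}" using r assms by auto
  moreover have "M u v 0 \<in> {u..v}" "M u v 1 \<in> {u..v}" using r by auto
  ultimately show "M u v 0 = u" "M u v 1 = v" using b by fastforce+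
qed

lemma negative_direction_less:
  assumes "negative_direction M" "0 < u" "u < v"
  shows "M u v 0 = v" "M u v 1 = u"
proof -
  have m: "strict_antimono_on {0..1} (M u v)"
    using assms by (auto simp: negative_direction_def)
  have r: "M u v ` {0..1} = {u..v}" using range[of u v] assms by simp
  have b: "M u v 1 \<le> M u v l \<and> M u v l \<le> M u v 0" if "l \<in> {0..1}" for l
    using monotone_onD[OF m, of l 1] monotone_onD[OF m, of 0 l] that
    by (cases "l = 0"; cases "l = 1") auto
  have "u \<in> M u v ` {0..1}" "v \<in> M u v ` {0..1}" using r assms by auto
  moreover have "M u v 0 \<in> {u..v}" "M u v 1 \<in> {u..v}" using r by auto
  ultimately show "M u v 0 = v" "M u v 1 = u" using b by fastforce+
qed

lemma positive_direction_endpoints: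
  assumes "positive_direction M" "0 < u" "0 < v"
  shows "M u v 0 = u" "M u v 1 = v"
  using positive_direction_less[of u v] positive_direction_less[of v u]
    swap[of u v 0] swap[of u v 1] idem[of u] assms
  by (cases u v rule: linorder_cases; simp)+

lemma negative_direction_endpoints:
  assumes "negative_direction M" "0 < u" "0 < v"
  shows "M u v 0 = v" "M u v 1 = u"
  using negative_direction_less[of u v] negative_direction_less[of v u]
    swap[of u v 0] swap[of u v 1] idem[of u] assms
  by (cases u v rule: linorder_cases; simp)+

end

definition same_direction ::
  "(real \<Rightarrow> real \<Rightarrow> real \<Rightarrow> real) \<Rightarrow> (real \<Rightarrow> real \<Rightarrow> real \<Rightarrow> real) \<Rightarrow> bool" where
  "same_direction M N \<longleftrightarrow>
    (positive_direction M \<and> positive_direction N) \<or> (negative_direction M \<and> negative_direction N)"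

definition mean_convex ::
  "(real \<Rightarrow> real \<Rightarrow> real \<Rightarrow> real) \<Rightarrow> (real \<Rightarrow> real \<Rightarrow> real \<Rightarrow> real) \<Rightarrow>
    real set \<Rightarrow> real set \<Rightarrow> (real \<Rightarrow> real) \<Rightarrow> bool" where
  "mean_convex M N I J f \<longleftrightarrow> f \<in> I \<rightarrow> J \<and>
    (\<forall>u\<in>I. \<forall>v\<in>I. \<forall>l\<in>{0..1}. f (M u v l) \<le> N (f u) (f v) l)"

end

theory Submission
  imports Defs
begin

text \<open>Chain two inequalities: \<open>g\<close> preserves the bound that convexity of
  \<open>f\<close> gives for \<open>f (M u v l)\<close>, and convexity of \<open>g\<close> at the
  points \<open>f u\<close>, \<open>f v\<close> replaces \<open>N\<close> by \<open>K\<close>. Since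
  \<open>g\<close> is monotone only on \<open>J\<close>, both compared values must lie in
  \<open>J\<close>; this rests on \<open>mean_mem_interval\<close>, the closure of intervals under
  means.\<close>

text \<open>The values of a mean lie between its two arguments, and an interval contains everything
  between two of its points.\<close>

lemma (in weighted_mean) mean_mem_interval:
  assumes "is_interval S" "S \<subseteq> {0<..}" "u \<in> S" "v \<in> S" "l \<in> {0..1}"
  shows "M u v l \<in> S"
\<comment> \<open>The axiom \<open>range\<close> covers only distinct arguments; on the diagonal
  \<open>idem\<close> takes its place.\<close>
proof (cases "u = v")
  case True
  then show ?thesis using idem assms by auto
next
  case False
  have "0 < u" "0 < v" using assms by auto
  then have "M u v ` {0..1} = {min u v..max u v}" using range False by simp
  then have "M u v l \<in> {min u v..max u v}"
    using imageI[OF assms(5), of "M u v"] by simp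
  moreover have "min u v \<in> S" "max u v \<in> S"
    using assms(3,4) by (simp_all add: min_def max_def)
  ultimately show ?thesis
    using mem_is_interval_1_I[OF assms(1)] by (meson atLeastAtMost_iff)
qed

theorem theorem4:
  fixes M N K :: "real \<Rightarrow> real \<Rightarrow> real \<Rightarrow> real"
    and I J L :: "real set"
    and f g :: "real \<Rightarrow> real"
  assumes "weighted_mean M" and "weighted_mean N" and "weighted_mean K"
    and "same_direction M N" and "same_direction N K"
    and "is_interval I" and "I \<subseteq> {0<..}"
    and "is_interval J" and "J \<subseteq> {0<..}"
    and "is_interval L" and "L \<subseteq> {0<..}"
    and "mean_convex M N I J f"
    and "mono_on J g"
    and "mean_convex N K J L g"
  shows "mean_convex M K I L (g \<circ> f)"
proof -
  have f: "f u \<in> J" if "u \<in> I" for u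
    using assms(12) that by (auto simp: mean_convex_def)
  have g: "g x \<in> L" if "x \<in> J" for x
    using assms(14) that by (auto simp: mean_convex_def)
  have "g (f (M u v l)) \<le> K (g (f u)) (g (f v)) l"
    if uv: "u \<in> I" "v \<in> I" and l: "l \<in> {0..1}" for u v l
  proof -
    \<comment> \<open>Membership in \<open>I\<close> ensures that \<open>f (M u v l)\<close> lies in
      \<open>J\<close>, where \<open>g\<close> is monotone.\<close>
    have "M u v l \<in> I"
      using weighted_mean.mean_mem_interval[OF assms(1)] assms(6,7) uv l by simp
    moreover have "N (f u) (f v) l \<in> J"
      using weighted_mean.mean_mem_interval[OF assms(2)] assms(8,9) f[OF uv(1)] f[OF uv(2)] l by simp
    moreover have "f (M u v l) \<le> N (f u) (f v) l"
      using assms(12) uv l by (simp add: mean_convex_def)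
    ultimately have "g (f (M u v l)) \<le> g (N (f u) (f v) l)"
      using mono_onD[OF assms(13) f] by simp
    also have "\<dots> \<le> K (g (f u)) (g (f v)) l"
      using assms(14) f[OF uv(1)] f[OF uv(2)] l by (simp add: mean_convex_def)
    finally show ?thesis .
  qed
  then show ?thesis
    using f g by (auto simp: mean_convex_def)
qed

end
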